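(* Let $\mathfrak g$ be a metric Lie algebra with $Ann_R(\mathfrak g)=Ann(\mathfrak g)$. Then there exists an orthogonal direct sum decomposition $$\mathfrak g=\mathfrak g_0\oplus\mathfrak g_1\oplus\cdots\oplus\mathfrak g_l$$ where $\mathfrak g_0$ is a maximal non-degenerate subspace of $Ann(\mathfrak g)$ (possibly zero), and each $\mathfrak g_i$ with $i\geq1$ is an indecomposable non-degenerate strong ideal of $\mathfrak g$ whose right annihilator $Ann_R(\mathfrak g_i)$ is totally isotropic.
   Context: A metric Lie algebra is a finite-dimensional real Lie algebra $\mathfrak g$ with a non-degenerate symmetric bilinear form $\langle\cdot,\cdot\rangle$ (of arbitrary signature). Its Levi-Civita product $\nabla_XY$ is the bilinear product determined by $2\langle\nabla_XY,Z\rangle=\langle[X,Y],Z\rangle-\langle[Y,Z],X\rangle+\langle[Z,X],Y\rangle$. For subspaces, $\nabla_{\mathfrak a}\mathfrak b$ is the linear span of all $\nabla_XY$ with $X\in\mathfrak a$, $Y\in\mathfrak b$. $Ann_R(\mathfrak g)=\{X\in\mathfrak g:\nabla_YX=0\ \forall Y\in\mathfrak g\}$ and $Ann(\mathfrak g)=\{X\in\mathfrak g:\nabla_YX=\nabla_XY=0\ \forall Y\in\mathfrak g\}$. A subspace is totally isotropic if $\langle X,Y\rangle=0$ for all $X,Y$ in it, and non-degenerate if $\langle\cdot,\cdot\rangle$ restricts to a non-degenerate form on it. A subspace $\mathfrak h$ is a strong ideal if $\nabla_{\mathfrak g}\mathfrak h\subseteq\mathfrak h$ and $\nabla_{\mathfrak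 h}\mathfrak g\subseteq\mathfrak h$. A metric Lie algebra is decomposable if it is a direct sum of two non-zero, non-degenerate strong ideals, and indecomposable otherwise; a non-degenerate strong ideal is itself regarded as a metric Lie algebra with the restricted bracket and form (its Levi-Civita product is then the restriction of $\nabla$). Orthogonal means that distinct summands are orthogonal for $\langle\cdot,\cdot\rangle$. The case $l=0$ (no summands with $i\ge 1$) is allowed. *)

theory Defs
  imports Complex_Main "HOL-Library.FuncSet"
begin

text \<open>
  All structures live on a subspace of an ambient real vector space, so that a non-degenerate
  strong ideal is a metric Lie algebra under the very same bracket and form.  The values of these
  functions outside the carrier are irrelevant.
\<close>

definition bilinear_on :: "'a::real_vector set \<Rightarrow> ('a \<Rightarrow> 'a \<Rightarrow> 'b::real_vector) \<Rightarrow> bool" where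
  "bilinear_on V f \<longleftrightarrow>
     (\<forall>x\<in>V. \<forall>y\<in>V. \<forall>z\<in>V. f (x + y) z = f x z + f y z \<and> f z (x + y) = f z x + f z y) \<and>
     (\<forall>c. \<forall>x\<in>V. \<forall>y\<in>V. f (c *\<^sub>R x) y = c *\<^sub>R f x y \<and> f x (c *\<^sub>R y) = c *\<^sub>R f x y)"

definition nondegenerate_on :: "'a::real_vector set \<Rightarrow> ('a \<Rightarrow> 'a \<Rightarrow> real) \<Rightarrow> bool" where
  "nondegenerate_on V form \<longleftrightarrow> (\<forall>x\<in>V. (\<forall>y\<in>V. form x y = 0) \<longrightarrow> x = 0)"

definition totally_isotropic :: "('a \<Rightarrow> 'a \<Rightarrow> real) \<Rightarrow> 'a set \<Rightarrow> bool" where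
  "totally_isotropic form V \<longleftrightarrow> (\<forall>x\<in>V. \<forall>y\<in>V. form x y = 0)"

locale lie_algebra =
  fixes g :: "'a::real_vector set" and br :: "'a \<Rightarrow> 'a \<Rightarrow> 'a"
  assumes carrier_subspace: "subspace g"
    and finite_dimensional: "\<exists>S. finite S \<and> span S = g"
    and bracket_closed: "\<And>x y. x \<in> g \<Longrightarrow> y \<in> g \<Longrightarrow> br x y \<in> g"
    and bracket_bilinear: "bilinear_on g br"
    and bracket_alternating: "\<And>x. x \<in> g \<Longrightarrow> br x x = 0"
    and jacobi: "\<And>x y z. x \<in> g \<Longrightarrow> y \<in> g \<Longrightarrow> z \<in> g \<Longrightarrow>
        br x (br y z) + br y (br z x) + br z (br x y) = 0"

locale metric_lie_algebra = lie_algebra g br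
  for g :: "'a::real_vector set" and br :: "'a \<Rightarrow> 'a \<Rightarrow> 'a" +
  fixes form :: "'a \<Rightarrow> 'a \<Rightarrow> real"
  assumes form_bilinear: "bilinear_on g form"
    and form_symmetric: "\<And>x y. x \<in> g \<Longrightarrow> y \<in> g \<Longrightarrow> form x y = form y x"
    and form_nondegenerate: "nondegenerate_on g form"

text \<open>
  The Levi-Civita product; the Koszul formula has exactly one solution \<open>w\<close> in \<open>g\<close>
  when \<open>g\<close> is a metric Lie algebra and \<open>x\<close>, \<open>y\<close> are in \<open>g\<close>.
\<close>

definition levi_civita ::
    "'a::real_vector set \<Rightarrow> ('a \<Rightarrow> 'a \<Rightarrow> 'a) \<Rightarrow> ('a \<Rightarrow> 'a \<Rightarrow> real) \<Rightarrow> 'a \<Rightarrow> 'a \<Rightarrow> 'a" where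
  "levi_civita g br form x y =
     (THE w. w \<in> g \<and>
        (\<forall>z\<in>g. 2 * form w z = form (br x y) z - form (br y z) x + form (br z x) y))"

definition levi_civita_span ::
    "'a::real_vector set \<Rightarrow> ('a \<Rightarrow> 'a \<Rightarrow> 'a) \<Rightarrow> ('a \<Rightarrow> 'a \<Rightarrow> real) \<Rightarrow> 'a set \<Rightarrow> 'a set \<Rightarrow> 'a set" where
  "levi_civita_span g br form A B = span {levi_civita g br form x y | x y. x \<in> A \<and> y \<in> B}"

definition Ann_R ::
    "'a::real_vector set \<Rightarrow> ('a \<Rightarrow> 'a \<Rightarrow> 'a) \<Rightarrow> ('a \<Rightarrow> 'a \<Rightarrow> real) \<Rightarrow> 'a set" where
  "Ann_R g br form = {x \<in> g. \<forall>y\<in>g. levi_civita g br form y x = 0}"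

definition Ann ::
    "'a::real_vector set \<Rightarrow> ('a \<Rightarrow> 'a \<Rightarrow> 'a) \<Rightarrow> ('a \<Rightarrow> 'a \<Rightarrow> real) \<Rightarrow> 'a set" where
  "Ann g br form =
     {x \<in> g. \<forall>y\<in>g. levi_civita g br form y x = 0 \<and> levi_civita g br form x y = 0}"

definition strong_ideal ::
    "'a::real_vector set \<Rightarrow> ('a \<Rightarrow> 'a \<Rightarrow> 'a) \<Rightarrow> ('a \<Rightarrow> 'a \<Rightarrow> real) \<Rightarrow> 'a set \<Rightarrow> bool" where
  "strong_ideal g br form h \<longleftrightarrow>
     subspace h \<and> h \<subseteq> g \<and>
     levi_civita_span g br form g h \<subseteq> h \<and> levi_civita_span g br form h g \<subseteq> h"

text \<open>The two summands are not required to be orthogonal to each other.\<close>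

definition decomposable ::
    "'a::real_vector set \<Rightarrow> ('a \<Rightarrow> 'a \<Rightarrow> 'a) \<Rightarrow> ('a \<Rightarrow> 'a \<Rightarrow> real) \<Rightarrow> bool" where
  "decomposable g br form \<longleftrightarrow>
     (\<exists>h k. strong_ideal g br form h \<and> nondegenerate_on h form \<and> h \<noteq> {0} \<and>
            strong_ideal g br form k \<and> nondegenerate_on k form \<and> k \<noteq> {0} \<and>
            g = {x + y | x y. x \<in> h \<and> y \<in> k} \<and> h \<inter> k = {0})"

abbreviation indecomposable ::
    "'a::real_vector set \<Rightarrow> ('a \<Rightarrow> 'a \<Rightarrow> 'a) \<Rightarrow> ('a \<Rightarrow> 'a \<Rightarrow> real) \<Rightarrow> bool" where
  "indecomposable g br form \<equiv> \<not> decomposable g br form"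

definition maximal_nondegenerate_subspace ::
    "('a \<Rightarrow> 'a \<Rightarrow> real) \<Rightarrow> 'a::real_vector set \<Rightarrow> 'a set \<Rightarrow> bool" where
  "maximal_nondegenerate_subspace form V W \<longleftrightarrow>
     subspace W \<and> W \<subseteq> V \<and> nondegenerate_on W form \<and>
     (\<forall>U. subspace U \<and> U \<subseteq> V \<and> nondegenerate_on U form \<and> W \<subseteq> U \<longrightarrow> U = W)"

text \<open>
  Internal direct sum: every element of \<open>V\<close> is the sum of a unique family of components, and
  all such sums lie in \<open>V\<close>.
\<close>

definition direct_sum_decomposition ::
    "'a::real_vector set \<Rightarrow> 'i set \<Rightarrow> ('i \<Rightarrow> 'a set) \<Rightarrow> bool" where
  "direct_sum_decomposition V I W \<longleftrightarrow>
     finite I \<and> (\<forall>i\<in>I. subspace (W i)) \<and>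
     bij_betw (\<lambda>f. \<Sum>i\<in>I. f i) (Pi\<^sub>E I W) V"

definition pairwise_orthogonal ::
    "('a \<Rightarrow> 'a \<Rightarrow> real) \<Rightarrow> 'i set \<Rightarrow> ('i \<Rightarrow> 'a set) \<Rightarrow> bool" where
  "pairwise_orthogonal form I W \<longleftrightarrow>
     (\<forall>i\<in>I. \<forall>j\<in>I. i \<noteq> j \<longrightarrow> (\<forall>x\<in>W i. \<forall>y\<in>W j. form x y = 0))"

end

theory Submission
  imports Defs
begin

text \<open>
  Metric compatibility makes the orthogonal complement of a strong ideal stable under every
  \<open>\<nabla>\<^sub>X\<close>.  If a metric Lie algebra with \<open>Ann\<^sub>R = Ann\<close> is the direct sum of non-degenerate strong
  ideals \<open>a\<close> and \<open>b\<close>, write \<open>X \<in> a\<^sup>\<bottom>\<close> as \<open>X\<^sub>a + X\<^sub>b\<close>.  For \<open>Z \<in> a\<close> the vector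
  \<open>\<nabla>\<^sub>Z X\<close> lies in \<open>a \<inter> a\<^sup>\<bottom> = 0\<close>, hence \<open>X\<^sub>a\<close> lies in the right annihilator, so in
  the annihilator, and also \<open>\<nabla>\<^sub>X Z = 0\<close>.  Therefore \<open>a\<^sup>\<bottom>\<close> is a strong ideal and the
  decomposition can be replaced by the orthogonal one \<open>a \<oplus> a\<^sup>\<bottom>\<close>.  Splitting off a maximal
  non-degenerate subspace of the annihilator first makes the right annihilator of the rest totally
  isotropic, and both annihilator conditions are inherited by orthogonal summands, so that
  induction on the dimension applies.
\<close>

section \<open>Finite-dimensional subspaces and bilinear forms\<close>

text \<open>The ambient type may be infinite-dimensional, so finiteness is supplied by the spanning
  set \<open>S\<close>: independent vectors in \<open>span S\<close> number at most
  \<open>card S\<close>. An empty \<open>A\<close> yields a plain basis; taking \<open>A\<close> to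
  be a basis of a smaller subspace allows dimensions to be compared.\<close>

lemma finite_basis_extending:
  assumes "subspace V" and "finite S" and "V \<subseteq> span S" and "A \<subseteq> V" and "independent A"
  obtains B where "A \<subseteq> B" and "B \<subseteq> V" and "independent B" and "span B = V" and "finite B"
    and "dim V = card B" and "card B \<le> card S"
proof -
  obtain B where B: "A \<subseteq> B" "B \<subseteq> V" "independent B" "V \<subseteq> span B"
    using maximal_independent_subset_extend[OF assms(4,5)] by blast
  have sp: "span B = V"
    using B assms(1) by (simp add: span_minimal subset_antisym)
  have "finite B \<and> card B \<le> card S"
    using independent_span_bound[OF assms(2) B(3)] B(2) assms(3) by blast
  moreover have "dim V = card B"
    using B by (intro dim_unique) auto
  ultimately show thesis
    using B sp that by blast
qed

lemma dim_strict_mono: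
  assumes "subspace U" and "subspace V" and "finite S" and "V \<subseteq> span S" and "U \<subset> V"
  shows "dim U < dim V"
proof -
  obtain A where A: "A \<subseteq> U" "independent A" "span A = U" "dim U = card A"
    by (rule finite_basis_extending[OF assms(1,3) _ empty_subsetI independent_empty])
      (use assms(4,5) in auto)
  obtain B where B: "A \<subseteq> B" "span B = V" "finite B" "dim V = card B"
    by (rule finite_basis_extending[OF assms(2,3,4) _ A(2)]) (use A(1) assms(5) in auto)
  have "A \<noteq> B"
    using A B assms(5) by blast
  then show ?thesis
    using A B by (simp add: psubset_card_mono psubset_eq)
qed

lemma finite_dimensional_subset:
  fixes U :: "'a::real_vector set"
  assumes "subspace U" and "U \<subseteq> V" and "\<exists>S. finite S \<and> span S = V"
  shows "\<exists>S. finite S \<and> span S = U"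
proof -
  obtain S where S: "finite S" "span S = V"
    using assms(3) by blast
  show ?thesis
    by (rule finite_basis_extending[OF assms(1) S(1) _ empty_subsetI independent_empty])
      (use S(2) assms(2) in auto)
qed

section \<open>Maps that are linear or bilinear on a subspace only\<close>

lemma bilinear_onD:
  assumes "bilinear_on V f"
  shows "x \<in> V \<Longrightarrow> y \<in> V \<Longrightarrow> z \<in> V \<Longrightarrow> f (x + y) z = f x z + f y z"
    and "x \<in> V \<Longrightarrow> y \<in> V \<Longrightarrow> z \<in> V \<Longrightarrow> f z (x + y) = f z x + f z y"
    and "x \<in> V \<Longrightarrow> y \<in> V \<Longrightarrow> f (c *\<^sub>R x) y = c *\<^sub>R f x y"
    and "x \<in> V \<Longrightarrow> y \<in> V \<Longrightarrow> f x (c *\<^sub>R y) = c *\<^sub>R f x y"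
  using assms unfolding bilinear_on_def by blast+

lemma bilinear_on_subset: "bilinear_on V f \<Longrightarrow> U \<subseteq> V \<Longrightarrow> bilinear_on U f"
  unfolding bilinear_on_def by blast

lemma bilinear_on_0:
  assumes "bilinear_on V f" and "x \<in> V"
  shows "f 0 x = 0" and "f x 0 = 0"
  using bilinear_onD(3)[OF assms(1) assms(2) assms(2), of 0]
    bilinear_onD(4)[OF assms(1) assms(2) assms(2), of 0] by simp_all

lemma bilinear_on_minus:
  assumes "bilinear_on V f" and "x \<in> V" and "y \<in> V"
  shows "f (- x) y = - f x y" and "f x (- y) = - f x y"
  using bilinear_onD(3)[OF assms, of "-1"] bilinear_onD(4)[OF assms, of "-1"] by simp_all

lemma bilinear_on_diff:
  assumes "bilinear_on V f" and "subspace V" and "x \<in> V" and "y \<in> V" and "z \<in> V"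
  shows "f (x - y) z = f x z - f y z" and "f z (x - y) = f z x - f z y"
  using bilinear_onD(1)[OF assms(1,3) _ assms(5), of "- y"]
    bilinear_onD(2)[OF assms(1,3) _ assms(5), of "- y"]
    bilinear_on_minus[OF assms(1,4,5)] bilinear_on_minus[OF assms(1,5,4)]
    subspace_neg[OF assms(2,4)] by simp_all

lemma bilinear_on_sum_left:
  assumes "bilinear_on V f" and "subspace V" and "z \<in> V" and "\<And>i. i \<in> I \<Longrightarrow> x i \<in> V"
  shows "f (\<Sum>i\<in>I. x i) z = (\<Sum>i\<in>I. f (x i) z)"
  using assms(4)
proof (induction I rule: infinite_finite_induct)
  case (insert i F)
  then show ?case
    using bilinear_onD(1)[OF assms(1), of "x i" "\<Sum>i\<in>F. x i" z] assms(2,3)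
    by (simp add: subspace_sum)
qed (use bilinear_on_0[OF assms(1,3)] in auto)

text \<open>Both maps are known to be linear only on \<open>V\<close>, so the induction over the
  span carries membership in \<open>V\<close> along with the equality.\<close>

lemma linear_eq_on_span:
  assumes V: "subspace V" and B: "B \<subseteq> V"
    and phi: "\<And>x y. x \<in> V \<Longrightarrow> y \<in> V \<Longrightarrow> phi (x + y) = phi x + phi y"
      "\<And>c x. x \<in> V \<Longrightarrow> phi (c *\<^sub>R x) = c *\<^sub>R phi x"
    and psi: "\<And>x y. x \<in> V \<Longrightarrow> y \<in> V \<Longrightarrow> psi (x + y) = psi x + psi y"
      "\<And>c x. x \<in> V \<Longrightarrow> psi (c *\<^sub>R x) = c *\<^sub>R psi x"
    and eq: "\<And>b. b \<in> B \<Longrightarrow> phi b = psi b"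
    and x: "x \<in> span B"
  shows "phi x = (psi x :: 'b::real_vector)"
proof -
  have z: "phi 0 = 0" "psi 0 = 0"
    using phi(2)[of 0 0] psi(2)[of 0 0] subspace_0[OF V] by auto
  have "x \<in> V \<and> phi x = psi x"
    using x
  proof (induction rule: span_induct_alt)
    case base
    then show ?case
      using z subspace_0[OF V] by simp
  next
    case (step c b y)
    then have "b \<in> V" "c *\<^sub>R b \<in> V"
      using B V by (auto intro: subspace_scale)
    then show ?case
      using step V phi psi eq by (simp add: subspace_add)
  qed
  then show ?thesis
    by blast
qed

text \<open>Reading the functional \<open>form w\<close> through its values on a basis turns
  \<open>w\<close> into the vector \<open>T w\<close> of \<open>V\<close>. Non-degeneracy makes this
  endomorphism injective, hence surjective in finite dimension, and a preimage of the vector with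
  coordinates \<open>phi b\<close> represents \<open>phi\<close>.\<close>

lemma nondegenerate_representation:
  fixes form :: "'a::real_vector \<Rightarrow> 'a \<Rightarrow> real"
  assumes V: "subspace V" "\<exists>S. finite S \<and> span S = V"
    and form: "bilinear_on V form" "nondegenerate_on V form"
    and phi: "\<And>x y. x \<in> V \<Longrightarrow> y \<in> V \<Longrightarrow> phi (x + y) = phi x + phi y"
      "\<And>c x. x \<in> V \<Longrightarrow> phi (c *\<^sub>R x) = c * phi x"
  shows "\<exists>w\<in>V. \<forall>z\<in>V. form w z = phi z"
proof -
  obtain S where S: "finite S" "span S = V"
    using V(2) by blast
  obtain B where B: "B \<subseteq> V" "independent B" "span B = V" "finite B"
    by (rule finite_basis_extending[OF V(1) S(1) _ empty_subsetI independent_empty])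
      (use S(2) in auto)
  define T where "T w = (\<Sum>b\<in>B. form w b *\<^sub>R b)" for w
  \<comment> \<open>\<open>T\<close> is additive and homogeneous only on \<open>V\<close>;
    \<open>G\<close> is a linear map on the whole type that coincides with it there.\<close>
  obtain G where G: "linear G" "\<forall>b\<in>B. G b = T b"
    using linear_independent_extend[OF B(2)] by blast
  have T_add: "T (x + y) = T x + T y" if "x \<in> V" "y \<in> V" for x y
    using that B(1) bilinear_onD(1)[OF form(1)]
    by (auto simp: T_def scaleR_left_distrib sum.distrib[symmetric] intro!: sum.cong)
  have T_scale: "T (c *\<^sub>R x) = c *\<^sub>R T x" if "x \<in> V" for c x
    using that B(1) bilinear_onD(3)[OF form(1)]
    by (auto simp: T_def scaleR_sum_right intro!: sum.cong)
  have GT: "G x = T x" if "x \<in> V" for x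
    by (rule linear_eq_on_span[OF V(1) B(1)])
      (use G that B(3) T_add T_scale in \<open>auto simp: linear_add linear_scale\<close>)
  \<comment> \<open>Used twice: with the zero functional for injectivity, and with
    \<open>phi\<close> for the final identification.\<close>
  have agree: "\<forall>z\<in>V. form w z = psi z"
    if psi: "\<And>x y. x \<in> V \<Longrightarrow> y \<in> V \<Longrightarrow> psi (x + y) = psi x + psi y"
        "\<And>c x. x \<in> V \<Longrightarrow> psi (c *\<^sub>R x) = c * psi x"
      and w: "w \<in> V" "\<And>b. b \<in> B \<Longrightarrow> form w b = psi b"
    for w psi
  proof
    fix z assume "z \<in> V"
    show "form w z = psi z"
      by (rule linear_eq_on_span[OF V(1) B(1)])
        (use \<open>z \<in> V\<close> w psi B(3) bilinear_onD(2,4)[OF form(1)] in auto)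
  qed
  have coeffs: "(\<And>b. b \<in> B \<Longrightarrow> u b = v b)" if "(\<Sum>b\<in>B. u b *\<^sub>R b) = (\<Sum>b\<in>B. v b *\<^sub>R b)" for u v
  proof -
    fix b assume b: "b \<in> B"
    have "(\<Sum>b\<in>B. (u b - v b) *\<^sub>R b) = 0"
      using that by (simp add: scaleR_left_diff_distrib sum_subtractf)
    then have "u b - v b = 0"
      by (rule independentD[OF B(2) B(4) subset_refl _ b, where u = "\<lambda>b. u b - v b"])
    then show "u b = v b"
      by simp
  qed
  have inj: "inj_on G (span B)"
  proof (rule inj_onI)
    fix x y assume xy: "x \<in> span B" "y \<in> span B" "G x = G y"
    then have "x \<in> V" "y \<in> V"
      using B by auto
    then have d: "x - y \<in> V"
      using V by (simp add: subspace_diff)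
    have "T (x - y) = (\<Sum>b\<in>B. 0 *\<^sub>R b)"
      using GT[OF d] xy G(1) by (simp add: linear_diff)
    then have "\<And>b. b \<in> B \<Longrightarrow> form (x - y) b = 0"
      unfolding T_def by (rule coeffs)
    then have "\<forall>z\<in>V. form (x - y) z = 0"
      by (intro agree[OF _ _ d, of "\<lambda>_. 0"]) auto
    then show "x = y"
      using form(2) d unfolding nondegenerate_on_def by fastforce
  qed
  have indep: "independent (G ` B)"
    using linear_independent_injective_image[OF G(1) B(2) inj] .
  have sub: "G ` B \<subseteq> span B"
    using G(2) by (auto simp: T_def intro!: span_sum span_scale intro: span_base)
  have card: "card (G ` B) = card B"
    using inj span_superset by (metis card_image inj_on_subset)
  \<comment> \<open>Surjectivity by counting: a basis vector outside \<open>span (G\<close>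
    B)\<open>would enlarge\<close>G \<open>B\<close> to \<open>card B + 1\<close> independent
    vectors inside \<open>span B\<close>.\<close>
  have "B \<subseteq> span (G ` B)"
  proof (rule ccontr)
    assume "\<not> B \<subseteq> span (G ` B)"
    then obtain b where b: "b \<in> B" "b \<notin> span (G ` B)"
      by blast
    then have "b \<notin> G ` B"
      using span_base by blast
    have "independent (insert b (G ` B))"
      using independent_insertI[OF b(2) indep] .
    then have "card (insert b (G ` B)) \<le> card B"
      using independent_span_bound[OF B(4)] sub b(1) span_base by (metis insert_subset)
    then show False
      using card B(4) \<open>b \<notin> G ` B\<close> by simp
  qed
  then have "V \<subseteq> G ` V"
    using B(3) linear_span_image[OF G(1), of B] by (metis span_minimal subspace_span)
  moreover have "(\<Sum>b\<in>B. phi b *\<^sub>R b) \<in> V"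
    using B(1) V(1) by (auto intro!: subspace_sum subspace_scale)
  ultimately have "(\<Sum>b\<in>B. phi b *\<^sub>R b) \<in> G ` V"
    by (rule subsetD)
  then obtain w where w: "w \<in> V" "G w = (\<Sum>b\<in>B. phi b *\<^sub>R b)"
    by (elim imageE) (rule that, simp_all only:)
  then have "\<And>b. b \<in> B \<Longrightarrow> form w b = phi b"
    using GT unfolding T_def by (intro coeffs) auto
  then have "\<forall>z\<in>V. form w z = phi z"
    by (intro agree[OF phi w(1)]) auto
  then show ?thesis
    using w by blast
qed

text \<open>Uniqueness of components comes from the form: pairing the difference of two
  representations with a vector of \<open>W j\<close> leaves only the \<open>j\<close>-th term by
  orthogonality, and non-degeneracy of \<open>W j\<close> makes that component zero. Existence is
  the spanning assumption.\<close>

lemma direct_sum_decompositionI: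
  fixes form :: "'a::real_vector \<Rightarrow> 'a \<Rightarrow> real"
  assumes I: "finite I" and V: "subspace V" and form: "bilinear_on V form"
    and W: "\<And>i. i \<in> I \<Longrightarrow> subspace (W i)" "\<And>i. i \<in> I \<Longrightarrow> nondegenerate_on (W i) form"
    and orth: "pairwise_orthogonal form I W"
    and sp: "span (\<Union>i\<in>I. W i) = V"
  shows "direct_sum_decomposition V I W"
proof -
  have sub: "W i \<subseteq> V" if "i \<in> I" for i
    using that sp span_superset by blast
  have inj: "inj_on (\<lambda>f. \<Sum>i\<in>I. f i) (Pi\<^sub>E I W)"
  proof (rule inj_onI)
    fix f f' assume f: "f \<in> Pi\<^sub>E I W" "f' \<in> Pi\<^sub>E I W" and eq: "(\<Sum>i\<in>I. f i) = (\<Sum>i\<in>I. f' i)"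
    have d: "f i - f' i \<in> W i" if "i \<in> I" for i
      using f that W(1) by (auto intro!: subspace_diff)
    show "f = f'"
    proof (rule PiE_ext[OF f])
      fix j assume j: "j \<in> I"
      have "form (f j - f' j) y = 0" if y: "y \<in> W j" for y
      proof -
        have "(\<Sum>i\<in>I. form (f i - f' i) y) = form (\<Sum>i\<in>I. f i - f' i) y"
          using d sub j y by (intro bilinear_on_sum_left[OF form V, symmetric]) auto
        also have "\<dots> = 0"
          using eq bilinear_on_0[OF form] sub j y by (auto simp: sum_subtractf)
        also have "(\<Sum>i\<in>I. form (f i - f' i) y) = (\<Sum>i\<in>I. if i = j then form (f j - f' j) y else 0)"
          using orth j y d unfolding pairwise_orthogonal_def by (intro sum.cong) auto
        finally show ?thesis
          using I j by simp
      qed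
      then show "f j = f' j"
        using W(2)[OF j] d[OF j] unfolding nondegenerate_on_def by fastforce
    qed
  qed
  \<comment> \<open>Induction over the finite subsets \<open>J\<close> of \<open>I\<close>; the
    update \<open>f(j := u)\<close> adds one component and keeps the family extensional.\<close>
  have "\<exists>f\<in>Pi\<^sub>E J W. x = (\<Sum>i\<in>J. f i)"
    if "finite J" "x \<in> span (\<Union>i\<in>J. W i)" "J \<subseteq> I" for x J
    using that
  proof (induction J arbitrary: x)
    case (insert j J)
    then have "x \<in> span (W j \<union> (\<Union>i\<in>J. W i))"
      by simp
    then obtain u v where uv: "u \<in> span (W j)" "v \<in> span (\<Union>i\<in>J. W i)" "x = u + v"
      unfolding span_Un by blast
    then obtain f where f: "f \<in> Pi\<^sub>E J W" "v = (\<Sum>i\<in>J. f i)"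
      using insert by blast
    have "u \<in> W j"
      using uv(1) W(1)[of j] insert.prems by (metis insert_subset span_eq_iff)
    then have "f(j := u) \<in> Pi\<^sub>E (insert j J) W"
      using f by (auto simp: PiE_def extensional_def)
    moreover have "(\<Sum>i\<in>J. (f(j := u)) i) = (\<Sum>i\<in>J. f i)"
      using insert by (intro sum.cong) auto
    ultimately show ?case
      using uv f insert by (intro bexI[of _ "f(j := u)"]) auto
  qed auto
  then have "V \<subseteq> (\<lambda>f. \<Sum>i\<in>I. f i) ` Pi\<^sub>E I W"
    using I sp by blast
  moreover have "(\<lambda>f. \<Sum>i\<in>I. f i) ` Pi\<^sub>E I W \<subseteq> V"
  proof (intro image_subsetI subspace_sum[OF V])
    fix f i assume "f \<in> Pi\<^sub>E I W" "i \<in> I"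
    then show "f i \<in> V"
      using sub by blast
  qed
  ultimately show ?thesis
    using I W(1) inj unfolding direct_sum_decomposition_def bij_betw_def by blast
qed

section \<open>The Levi-Civita product\<close>

context metric_lie_algebra
begin

abbreviation D :: "'a \<Rightarrow> 'a \<Rightarrow> 'a" where
  "D \<equiv> levi_civita g br form"

lemma bracket_antisym:
  assumes "x \<in> g" and "y \<in> g"
  shows "br y x = - br x y"
proof -
  note b = bilinear_onD[OF bracket_bilinear]
  have "x + y \<in> g"
    using assms carrier_subspace by (simp add: subspace_add)
  then have "br (x + y) (x + y) = br x x + br x y + (br y x + br y y)"
    using assms b by auto
  then have "br x y + br y x = 0"
    using assms \<open>x + y \<in> g\<close> bracket_alternating by simp
  then show ?thesis
    by (simp add: add_eq_0_iff)
qed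

lemma eq_if_form_eq:
  assumes "x \<in> g" and "y \<in> g" and "\<And>z. z \<in> g \<Longrightarrow> form x z = form y z"
  shows "x = y"
proof -
  have "x - y \<in> g"
    using assms carrier_subspace by (simp add: subspace_diff)
  moreover have "form (x - y) z = 0" if "z \<in> g" for z
    using that assms by (simp add: bilinear_on_diff[OF form_bilinear carrier_subspace])
  ultimately have "x - y = 0"
    using form_nondegenerate unfolding nondegenerate_on_def by blast
  then show ?thesis
    by simp
qed

text \<open>Non-degeneracy makes the Koszul solution unique, which resolves the definite
  description: a product is computed by exhibiting a vector that satisfies the formula.\<close>

lemma levi_civita_eqI:
  assumes "w \<in> g"
    and "\<And>z. z \<in> g \<Longrightarrow> 2 * form w z = form (br x y) z - form (br y z) x + form (br z x) y"
  shows "D x y = w"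
  unfolding levi_civita_def
proof (rule the_equality)
  fix v
  assume v: "v \<in> g \<and> (\<forall>z\<in>g. 2 * form v z = form (br x y) z - form (br y z) x + form (br z x) y)"
  show "v = w"
  proof (rule eq_if_form_eq)
    fix z assume "z \<in> g"
    then show "form v z = form w z"
      using v assms(2)[of z] by (metis mult_cancel_left zero_neq_numeral)
  qed (use v assms in auto)
qed (use assms in auto)

text \<open>The right-hand side of the Koszul formula is linear in \<open>z\<close>, so half of it
  is represented by a vector of \<open>g\<close>.\<close>

lemma levi_civita_exists:
  assumes "x \<in> g" and "y \<in> g"
  shows "\<exists>w\<in>g. \<forall>z\<in>g. 2 * form w z = form (br x y) z - form (br y z) x + form (br z x) y"
proof -
  let ?phi = "\<lambda>z. (form (br x y) z - form (br y z) x + form (br z x) y) / 2"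
  note b = bilinear_onD[OF bracket_bilinear] and f = bilinear_onD[OF form_bilinear]
  have "\<exists>w\<in>g. \<forall>z\<in>g. form w z = ?phi z"
  proof (rule nondegenerate_representation[OF carrier_subspace finite_dimensional
        form_bilinear form_nondegenerate])
    fix u v assume "u \<in> g" "v \<in> g"
    then show "?phi (u + v) = ?phi u + ?phi v"
      using assms by (simp add: b f bracket_closed field_simps)
  next
    fix c u assume "u \<in> g"
    then show "?phi (c *\<^sub>R u) = c * ?phi u"
      using assms by (simp add: b f bracket_closed field_simps)
  qed
  then show ?thesis
    by (auto simp: field_simps)
qed

lemma
  assumes "x \<in> g" and "y \<in> g"
  shows levi_civita_closed: "D x y \<in> g"
    and koszul: "\<And>z. z \<in> g \<Longrightarrow>
      2 * form (D x y) z = form (br x y) z - form (br y z) x + form (br z x) y"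
proof -
  let ?koszul = "\<lambda>w. \<forall>z\<in>g. 2 * form w z = form (br x y) z - form (br y z) x + form (br z x) y"
  obtain w where w: "w \<in> g" "?koszul w"
    using levi_civita_exists[OF assms] by (rule bexE)
  have "D x y = w"
    by (rule levi_civita_eqI[OF w(1) bspec[OF w(2)]])
  then have D: "D x y \<in> g" "?koszul (D x y)"
    using w by (simp_all only:)
  show "D x y \<in> g"
    by (rule D(1))
  show "2 * form (D x y) z = form (br x y) z - form (br y z) x + form (br z x) y" if "z \<in> g" for z
    by (rule bspec[OF D(2) that])
qed

text \<open>The right-hand side of the Koszul formula is linear in \<open>x\<close> and in
  \<open>y\<close>. By uniqueness of its solution, each identity reduces to checking the formula for
  the proposed value.\<close>

lemma bilinear_levi_civita: "bilinear_on g D"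
proof -
  note b = bilinear_onD[OF bracket_bilinear] and f = bilinear_onD[OF form_bilinear]
  note s = subspace_add[OF carrier_subspace] subspace_scale[OF carrier_subspace]
  have "D (x + y) z = D x z + D y z" if "x \<in> g" "y \<in> g" "z \<in> g" for x y z
  proof (rule levi_civita_eqI)
    fix w assume w: "w \<in> g"
    have "2 * form (D x z + D y z) w = 2 * form (D x z) w + 2 * form (D y z) w"
      using that w by (simp add: f levi_civita_closed)
    also have "\<dots> = form (br (x + y) z) w - form (br z w) (x + y) + form (br w (x + y)) z"
      using that w by (simp only: koszul) (simp add: b f s bracket_closed)
    finally show "2 * form (D x z + D y z) w =
        form (br (x + y) z) w - form (br z w) (x + y) + form (br w (x + y)) z" .
  qed (use that in \<open>simp add: s levi_civita_closed\<close>)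
  moreover have "D z (x + y) = D z x + D z y" if "x \<in> g" "y \<in> g" "z \<in> g" for x y z
  proof (rule levi_civita_eqI)
    fix w assume w: "w \<in> g"
    have "2 * form (D z x + D z y) w = 2 * form (D z x) w + 2 * form (D z y) w"
      using that w by (simp add: f levi_civita_closed)
    also have "\<dots> = form (br z (x + y)) w - form (br (x + y) w) z + form (br w z) (x + y)"
      using that w by (simp only: koszul) (simp add: b f s bracket_closed)
    finally show "2 * form (D z x + D z y) w =
        form (br z (x + y)) w - form (br (x + y) w) z + form (br w z) (x + y)" .
  qed (use that in \<open>simp add: s levi_civita_closed\<close>)
  moreover have "D (c *\<^sub>R x) y = c *\<^sub>R D x y" if "x \<in> g" "y \<in> g" for c x y
  proof (rule levi_civita_eqI)
    fix w assume w: "w \<in> g"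
    have "2 * form (c *\<^sub>R D x y) w = c * (2 * form (D x y) w)"
      using that w by (simp add: f levi_civita_closed)
    also have "\<dots> = form (br (c *\<^sub>R x) y) w - form (br y w) (c *\<^sub>R x) + form (br w (c *\<^sub>R x)) y"
      using that w
      by (simp only: koszul) (simp add: b f s bracket_closed distrib_left right_diff_distrib)
    finally show "2 * form (c *\<^sub>R D x y) w =
        form (br (c *\<^sub>R x) y) w - form (br y w) (c *\<^sub>R x) + form (br w (c *\<^sub>R x)) y" .
  qed (use that in \<open>simp add: s levi_civita_closed\<close>)
  moreover have "D x (c *\<^sub>R y) = c *\<^sub>R D x y" if "x \<in> g" "y \<in> g" for c x y
  proof (rule levi_civita_eqI)
    fix w assume w: "w \<in> g"
    have "2 * form (c *\<^sub>R D x y) w = c * (2 * form (D x y) w)"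
      using that w by (simp add: f levi_civita_closed)
    also have "\<dots> = form (br x (c *\<^sub>R y)) w - form (br (c *\<^sub>R y) w) x + form (br w x) (c *\<^sub>R y)"
      using that w
      by (simp only: koszul) (simp add: b f s bracket_closed distrib_left right_diff_distrib)
    finally show "2 * form (c *\<^sub>R D x y) w =
        form (br x (c *\<^sub>R y)) w - form (br (c *\<^sub>R y) w) x + form (br w x) (c *\<^sub>R y)" .
  qed (use that in \<open>simp add: s levi_civita_closed\<close>)
  ultimately show ?thesis
    unfolding bilinear_on_def by blast
qed

text \<open>Metric compatibility: by antisymmetry of the bracket, the right-hand side of the Koszul
  formula changes sign when \<open>y\<close> and \<open>z\<close> are exchanged.\<close>

lemma levi_civita_skew:
  assumes "x \<in> g" and "y \<in> g" and "z \<in> g"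
  shows "form (D x y) z = - form y (D x z)"
proof -
  have "form (br y x) z = - form (br x y) z" "form (br z y) x = - form (br y z) x"
    "form (br x z) y = - form (br z x) y"
    using assms bracket_antisym[of x y] bracket_antisym[of y z] bracket_antisym[of z x]
    by (simp_all add: bilinear_on_minus[OF form_bilinear] bracket_closed)
  then have "form (D x y) z = - form (D x z) y"
    using koszul[OF assms] koszul[OF assms(1,3,2)] by simp
  then show ?thesis
    using form_symmetric assms levi_civita_closed by simp
qed

text \<open>Subtracting the Koszul formulas for \<open>(x, y)\<close> and \<open>(y, x)\<close>
  cancels the last two terms and doubles the first. This recovers the bracket from the product, so
  strong ideals are closed under brackets.\<close>

lemma levi_civita_torsion_free:
  assumes "x \<in> g" and "y \<in> g"
  shows "D x y - D y x = br x y"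
proof (rule eq_if_form_eq)
  fix z assume z: "z \<in> g"
  have "form (br y x) z = - form (br x y) z" "form (br z y) x = - form (br y z) x"
    "form (br x z) y = - form (br z x) y"
    using assms z bracket_antisym[of x y] bracket_antisym[of y z] bracket_antisym[of z x]
    by (simp_all add: bilinear_on_minus[OF form_bilinear] bracket_closed)
  then show "form (D x y - D y x) z = form (br x y) z"
    using koszul[OF assms z] koszul[OF assms(2,1) z] assms z
    by (simp add: bilinear_on_diff[OF form_bilinear carrier_subspace] levi_civita_closed)
qed (use assms carrier_subspace in \<open>auto simp: levi_civita_closed bracket_closed subspace_diff\<close>)

text \<open>Since \<open>h\<close> is a subspace, containing the spans amounts to containing the
  products themselves.\<close>

lemma strong_ideal_iff:
  "strong_ideal g br form h \<longleftrightarrow>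
     subspace h \<and> h \<subseteq> g \<and> (\<forall>x\<in>g. \<forall>y\<in>h. D x y \<in> h \<and> D y x \<in> h)"
proof (cases "subspace h")
  case True
  then have "span A \<subseteq> h \<longleftrightarrow> A \<subseteq> h" for A
    by (metis order_trans span_minimal span_superset)
  then show ?thesis
    using True unfolding strong_ideal_def levi_civita_span_def by (simp only:) blast
qed (simp add: strong_ideal_def)

lemma subspace_Ann: "subspace (Ann g br form)"
  unfolding Ann_def using bilinear_onD[OF bilinear_levi_civita]
    bilinear_on_0[OF bilinear_levi_civita] carrier_subspace
  by (auto simp: subspace_def)

section \<open>Orthogonal splittings\<close>

definition perp :: "'a set \<Rightarrow> 'a set" where
  "perp W = {x \<in> g. \<forall>y\<in>W. form x y = 0}"

lemma subspace_perp:
  assumes "W \<subseteq> g"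
  shows "subspace (perp W)"
proof -
  have "form (x + y) w = form x w + form y w" "form (c *\<^sub>R x) w = c * form x w" "form 0 w = 0"
    if "x \<in> g" "y \<in> g" "w \<in> W" for x y w c
    using that assms bilinear_onD[OF form_bilinear] bilinear_on_0[OF form_bilinear] by auto
  then show ?thesis
    using carrier_subspace unfolding perp_def subspace_def by auto
qed

text \<open>The component in \<open>W\<close> is the vector representing the functional
  \<open>form x\<close> on \<open>W\<close>, which exists because \<open>W\<close> is
  non-degenerate.\<close>

lemma perp_decomposition:
  assumes W: "subspace W" "W \<subseteq> g" "nondegenerate_on W form" and x: "x \<in> g"
  shows "\<exists>u\<in>W. \<exists>v\<in>perp W. x = u + v"
proof -
  have "\<exists>w\<in>W. \<forall>z\<in>W. form w z = form x z"
    by (rule nondegenerate_representation[OF W(1)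
          finite_dimensional_subset[OF W(1,2) finite_dimensional]
          bilinear_on_subset[OF form_bilinear W(2)] W(3)])
      (use W x bilinear_onD[OF form_bilinear] in \<open>auto simp: subset_iff\<close>)
  then obtain w where w: "w \<in> W" "\<forall>z\<in>W. form w z = form x z"
    by blast
  then have "form (x - w) z = 0" if "z \<in> W" for z
    using that W(2) x bilinear_on_diff(1)[OF form_bilinear carrier_subspace x, of w z] by auto
  then have "x - w \<in> perp W"
    using w W(2) x carrier_subspace unfolding perp_def by (auto intro: subspace_diff)
  then show ?thesis
    using w by (intro bexI[of _ w] bexI[of _ "x - w"]) auto
qed

text \<open>Non-degeneracy of the parts and their trivial intersection are consequences of
  orthogonality and of non-degeneracy on \<open>g\<close>; see \<open>split_nondegenerate\<close>
  and \<open>split_inter\<close>.\<close>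

definition orthogonal_split :: "'a set \<Rightarrow> 'a set \<Rightarrow> bool" where
  "orthogonal_split h k \<longleftrightarrow>
     strong_ideal g br form h \<and> strong_ideal g br form k \<and>
     (\<forall>x\<in>h. \<forall>y\<in>k. form x y = 0) \<and> (\<forall>x\<in>g. \<exists>u\<in>h. \<exists>v\<in>k. x = u + v)"

lemma orthogonal_split_sym:
  assumes "orthogonal_split h k"
  shows "orthogonal_split k h"
proof -
  have hk: "h \<subseteq> g" "k \<subseteq> g"
    using assms unfolding orthogonal_split_def strong_ideal_def by auto
  have "\<exists>u\<in>k. \<exists>v\<in>h. x = u + v" if "x \<in> g" for x
    using assms that unfolding orthogonal_split_def by (metis add.commute)
  moreover have "form y x = 0" if "x \<in> h" "y \<in> k" for x y
    using that assms form_symmetric[of y x] hk unfolding orthogonal_split_def by auto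
  ultimately show ?thesis
    using assms unfolding orthogonal_split_def by blast
qed

text \<open>Skewness of \<open>D x\<close> gives stability of \<open>perp h\<close> under
  \<open>D x\<close> for every \<open>x\<close> in \<open>g\<close>. For \<open>x\<close> in
  \<open>perp h\<close> and arbitrary \<open>y\<close>, the same skewness turns
  \<open>form (D x y) z\<close> into \<open>- form y (D x z)\<close>, and the last hypothesis makes
  this vanish.\<close>

lemma orthogonal_split_perpI:
  assumes "strong_ideal g br form h" and "nondegenerate_on h form"
    and "\<And>x z. x \<in> perp h \<Longrightarrow> z \<in> h \<Longrightarrow> D x z = 0"
  shows "orthogonal_split h (perp h)"
proof -
  have h: "subspace h" "h \<subseteq> g" "\<And>x y. x \<in> g \<Longrightarrow> y \<in> h \<Longrightarrow> D x y \<in> h"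
    using assms(1) unfolding strong_ideal_iff by auto
  have p: "perp h \<subseteq> g"
    unfolding perp_def by auto
  have fp: "form y z = 0" "form z y = 0" if "y \<in> perp h" "z \<in> h" for y z
    using that form_symmetric h(2) unfolding perp_def by auto
  have "D x y \<in> perp h" if "x \<in> g" "y \<in> perp h" for x y
  proof -
    have "form (D x y) z = 0" if "z \<in> h" for z
      using levi_civita_skew[of x y z] \<open>x \<in> g\<close> \<open>y \<in> perp h\<close> that h p fp[of y "D x z"] by auto
    then show ?thesis
      using that p levi_civita_closed unfolding perp_def by auto
  qed
  moreover have "D x y \<in> perp h" if "x \<in> perp h" "y \<in> g" for x y
  proof -
    have "form (D x y) z = 0" if "z \<in> h" for z
      using levi_civita_skew[of x y z] \<open>y \<in> g\<close> \<open>x \<in> perp h\<close> that h(2) p assms(3)[of x z]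
        bilinear_on_0[OF form_bilinear] by auto
    then show ?thesis
      using that p levi_civita_closed unfolding perp_def by auto
  qed
  ultimately have "strong_ideal g br form (perp h)"
    unfolding strong_ideal_iff using subspace_perp[OF h(2)] p by blast
  then show ?thesis
    using assms(1) fp perp_decomposition[OF h(1,2) assms(2)]
    unfolding orthogonal_split_def by blast
qed

lemma decomposable_orthogonal_split:
  assumes "decomposable g br form" and ann: "Ann_R g br form = Ann g br form"
  obtains h k where "orthogonal_split h k" and "h \<subset> g" and "k \<subset> g"
proof -
  obtain a b where a: "strong_ideal g br form a" "nondegenerate_on a form" "a \<noteq> {0}"
    and b: "strong_ideal g br form b" "b \<noteq> {0}"
    and ab: "g = {x + y | x y. x \<in> a \<and> y \<in> b}" "a \<inter> b = {0}"
    using assms(1) unfolding decomposable_def by auto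
  have a': "subspace a" "a \<subseteq> g" "\<And>x y. x \<in> g \<Longrightarrow> y \<in> a \<Longrightarrow> D x y \<in> a \<and> D y x \<in> a"
    and b': "subspace b" "b \<subseteq> g" "\<And>x y. x \<in> g \<Longrightarrow> y \<in> b \<Longrightarrow> D x y \<in> b \<and> D y x \<in> b"
    using a b unfolding strong_ideal_iff by auto
  \<comment> \<open>Such products lie in both ideals, hence in \<open>a \<inter> b\<close>.\<close>
  have D0: "D x y = 0" "D y x = 0" if "x \<in> a" "y \<in> b" for x y
    using that a' b' ab(2) by blast+
  note D = bilinear_onD[OF bilinear_levi_civita]
  have "D x z = 0" if x: "x \<in> perp a" and z: "z \<in> a" for x z
  proof -
    have xg: "x \<in> g"
      using x unfolding perp_def by auto
    obtain u v where uv: "u \<in> a" "v \<in> b" "x = u + v"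
      using ab(1) xg by blast
    \<comment> \<open>The vector lies in the ideal \<open>a\<close> and, by skewness, is orthogonal
      to \<open>a\<close>; non-degeneracy of \<open>a\<close> forces it to be zero.\<close>
    have "D z' x = 0" if z': "z' \<in> a" for z'
    proof -
      have "D z' x \<in> a"
        using z' xg a' by blast
      moreover have "form (D z' x) w = 0" if "w \<in> a" for w
      proof -
        have "D z' w \<in> a"
          using that z' a' by blast
        then have "form x (D z' w) = 0"
          using x unfolding perp_def by blast
        then show ?thesis
          using levi_civita_skew[of z' x w] that z' xg a' by auto
      qed
      ultimately show ?thesis
        using a(2) unfolding nondegenerate_on_def by blast
    qed
    \<comment> \<open>The component \<open>v\<close> has zero product with \<open>a\<close>, so the
      vanishing passes from \<open>x\<close> to \<open>u\<close>. It then extends to all of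
      \<open>g\<close>, as \<open>b\<close> has zero product with \<open>u\<close> too.\<close>
    then have "D z' u = 0" if "z' \<in> a" for z'
      using that uv D0[of z' v] D(2)[of u v z'] a'(2) b'(2) by (auto simp: subset_iff)
    then have "D y u = 0" if "y \<in> g" for y
    proof -
      obtain y1 y2 where "y1 \<in> a" "y2 \<in> b" "y = y1 + y2"
        using \<open>y \<in> g\<close> ab(1) by blast
      then show ?thesis
        using \<open>\<And>z'. z' \<in> a \<Longrightarrow> D z' u = 0\<close> D0 uv D(1)[of y1 y2 u] a'(2) b'(2)
        by (auto simp: subset_iff)
    qed
    \<comment> \<open>The annihilator hypothesis enters here: it converts vanishing of
      \<open>D y u\<close> into vanishing of \<open>D u z\<close>.\<close>
    then have "u \<in> Ann g br form"
      using uv a'(2) unfolding ann[symmetric] Ann_R_def by auto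
    then have "D u z = 0"
      using z a'(2) unfolding Ann_def by blast
    then show ?thesis
      using uv z D0[of z v] D(1)[of u v z] a'(2) b'(2) by (auto simp: subset_iff)
  qed
  then have split: "orthogonal_split a (perp a)"
    using a by (intro orthogonal_split_perpI) auto
  \<comment> \<open>Properness of both parts makes the dimension drop in the later induction. If
    \<open>a\<close> were all of \<open>g\<close>, then \<open>b\<close> would be zero; if
    \<open>perp a\<close> were, the form would vanish on \<open>a\<close>.\<close>
  have "a \<noteq> g"
    using ab(2) b b'(1,2) by (metis Int_absorb1)
  moreover have "perp a \<noteq> g"
  proof
    assume eq: "perp a = g"
    have "x = 0" if "x \<in> a" for x
    proof -
      have "\<forall>y\<in>a. form x y = 0"
        using eq that a'(2) unfolding perp_def by blast
      then show ?thesis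
        using a(2) that unfolding nondegenerate_on_def by blast
    qed
    then show False
      using a(3) subspace_0[OF a'(1)] by blast
  qed
  moreover have "perp a \<subseteq> g"
    unfolding perp_def by auto
  ultimately show thesis
    using that split a'(2) by blast
qed

section \<open>Properties inherited by the summands of an orthogonal split\<close>

context
  fixes h k :: "'a set"
  assumes split: "orthogonal_split h k"
begin

lemma split_facts:
  shows split_subspace: "subspace h"
    and split_subset: "h \<subseteq> g" "k \<subseteq> g"
    and split_closed: "\<And>x y. x \<in> g \<Longrightarrow> y \<in> h \<Longrightarrow> D x y \<in> h" "\<And>x y. x \<in> g \<Longrightarrow> y \<in> h \<Longrightarrow> D y x \<in> h"
    and split_orthogonal: "\<And>x y. x \<in> h \<Longrightarrow> y \<in> k \<Longrightarrow> form x y = 0"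
    and split_sum: "\<And>x. x \<in> g \<Longrightarrow> \<exists>u\<in>h. \<exists>v\<in>k. x = u + v"
proof -
  have hk: "strong_ideal g br form h" "strong_ideal g br form k"
    "\<forall>x\<in>h. \<forall>y\<in>k. form x y = 0" "\<forall>x\<in>g. \<exists>u\<in>h. \<exists>v\<in>k. x = u + v"
    using split unfolding orthogonal_split_def by simp_all
  then show "subspace h" "h \<subseteq> g" "k \<subseteq> g"
    unfolding strong_ideal_def by simp_all
  have D: "\<forall>x\<in>g. \<forall>y\<in>h. D x y \<in> h \<and> D y x \<in> h"
    using hk(1) unfolding strong_ideal_iff by (elim conjE)
  show "D x y \<in> h" if "x \<in> g" "y \<in> h" for x y
    using bspec[OF bspec[OF D that(1)] that(2)] by (rule conjunct1)
  show "D y x \<in> h" if "x \<in> g" "y \<in> h" for x y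
    using bspec[OF bspec[OF D that(1)] that(2)] by (rule conjunct2)
  show "form x y = 0" if "x \<in> h" "y \<in> k" for x y
    by (rule bspec[OF bspec[OF hk(3) that(1)] that(2)])
  show "\<exists>u\<in>h. \<exists>v\<in>k. x = u + v" if "x \<in> g" for x
    by (rule bspec[OF hk(4) that])
qed

lemma split_eq_sum: "{x + y | x y. x \<in> h \<and> y \<in> k} = g"
proof
  show "{x + y | x y. x \<in> h \<and> y \<in> k} \<subseteq> g"
    using split_subset carrier_subspace by (auto intro!: subspace_add)
  show "g \<subseteq> {x + y | x y. x \<in> h \<and> y \<in> k}"
  proof
    fix x assume "x \<in> g"
    then obtain u v where "u \<in> h" "v \<in> k" "x = u + v"
      using split_sum by meson
    then show "x \<in> {x + y | x y. x \<in> h \<and> y \<in> k}"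
      by blast
  qed
qed

text \<open>A vector of \<open>h\<close> orthogonal to \<open>h\<close> is orthogonal to
  \<open>k\<close> as well, hence to all of \<open>g\<close>.\<close>

lemma split_nondegenerate: "nondegenerate_on h form"
  unfolding nondegenerate_on_def
proof (intro ballI impI)
  fix x assume x: "x \<in> h" "\<forall>y\<in>h. form x y = 0"
  have "form x z = 0" if z: "z \<in> g" for z
  proof -
    obtain u v where "u \<in> h" "v \<in> k" "z = u + v"
      using split_sum[OF z] by blast
    then show ?thesis
      using x split_orthogonal split_subset bilinear_onD(2)[OF form_bilinear, of u v x]
      by (auto simp: subset_iff)
  qed
  then show "x = 0"
    using form_nondegenerate x(1) split_subset unfolding nondegenerate_on_def by blast
qed

lemma split_inter: "h \<inter> k = {0}"
proof -
  have "x = 0" if "x \<in> h" "x \<in> k" for x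
    using that split_nondegenerate split_orthogonal form_symmetric split_subset
    unfolding nondegenerate_on_def by (metis subsetD)
  moreover have "0 \<in> h" "0 \<in> k"
    using split unfolding orthogonal_split_def strong_ideal_def by (auto intro: subspace_0)
  ultimately show ?thesis
    by blast
qed

lemma split_product_0:
  assumes "x \<in> h" and "y \<in> k"
  shows "D x y = 0" and "D y x = 0"
proof -
  have "D x y \<in> k" "D y x \<in> k"
    using split assms unfolding orthogonal_split_def strong_ideal_iff by auto
  then show "D x y = 0" "D y x = 0"
    using assms split_closed[of y x] split_subset split_inter by auto
qed

lemma split_metric_lie_algebra: "metric_lie_algebra h br form"
proof
  show "\<exists>S. finite S \<and> span S = h"
    by (rule finite_dimensional_subset[OF split_subspace split_subset(1) finite_dimensional])
  \<comment> \<open>The bracket is a difference of two products, each of which stays in the strong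
    ideal \<open>h\<close>.\<close>
  show "br x y \<in> h" if "x \<in> h" "y \<in> h" for x y
    using that levi_civita_torsion_free[of x y] split_subset split_closed split_subspace
    by (metis subsetD subspace_diff)
  show "bilinear_on h br" "bilinear_on h form"
    using bracket_bilinear form_bilinear split_subset by (auto intro: bilinear_on_subset)
  show "br x (br y z) + br y (br z x) + br z (br x y) = 0" if "x \<in> h" "y \<in> h" "z \<in> h" for x y z
    using that jacobi split_subset by blast
qed (use split_subspace split_subset split_nondegenerate bracket_alternating form_symmetric in
    \<open>auto simp: subset_iff\<close>)

text \<open>The product of \<open>g\<close> stays in \<open>h\<close> and satisfies the Koszul
  formula for test vectors in \<open>h\<close>, so uniqueness inside \<open>h\<close> identifies the
  two products.\<close>

lemma split_levi_civita:
  assumes "x \<in> h" and "y \<in> h"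
  shows "levi_civita h br form x y = D x y"
proof -
  interpret h: metric_lie_algebra h br form
    by (rule split_metric_lie_algebra)
  show ?thesis
  proof (rule h.levi_civita_eqI)
    have g: "x \<in> g" "y \<in> g"
      using assms split_subset(1) by auto
    show "D x y \<in> h"
      by (rule split_closed(1)[OF g(1) assms(2)])
    show "2 * form (D x y) z = form (br x y) z - form (br y z) x + form (br z x) y" if "z \<in> h" for z
      by (rule koszul[OF g subsetD[OF split_subset(1) that]])
  qed
qed

text \<open>Products between \<open>h\<close> and \<open>k\<close> vanish, so only the
  \<open>h\<close>-component of a left factor acts on a vector of \<open>h\<close>.\<close>

lemma split_Ann_R: "Ann_R h br form \<subseteq> Ann_R g br form"
proof
  fix x assume x: "x \<in> Ann_R h br form"
  then have xh: "x \<in> h" "\<And>y. y \<in> h \<Longrightarrow> D y x = 0"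
    using split_levi_civita unfolding Ann_R_def by auto
  have "D y x = 0" if "y \<in> g" for y
  proof -
    obtain u v where "u \<in> h" "v \<in> k" "y = u + v"
      using split_sum[OF \<open>y \<in> g\<close>] by blast
    then show ?thesis
      using xh split_product_0 split_subset bilinear_onD(1)[OF bilinear_levi_civita, of u v x]
      by (auto simp: subset_iff)
  qed
  then show "x \<in> Ann_R g br form"
    using xh split_subset unfolding Ann_R_def by auto
qed

lemma split_Ann_R_eq_Ann:
  assumes "Ann_R g br form = Ann g br form"
  shows "Ann_R h br form = Ann h br form"
proof
  show "Ann_R h br form \<subseteq> Ann h br form"
  proof
    fix x assume x: "x \<in> Ann_R h br form"
    then have "x \<in> Ann g br form"
      using split_Ann_R assms by blast
    then show "x \<in> Ann h br form"
      using x split_levi_civita split_subset unfolding Ann_R_def Ann_def by auto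
  qed
qed (auto simp: Ann_R_def Ann_def)

text \<open>Since \<open>s\<close> lies in \<open>h\<close>, the \<open>k\<close>-component of a
  vector of \<open>g\<close> multiplies \<open>s\<close> to zero from either side.\<close>

lemma split_strong_ideal_trans:
  assumes "strong_ideal h br form s"
  shows "strong_ideal g br form s"
proof -
  interpret h: metric_lie_algebra h br form
    by (rule split_metric_lie_algebra)
  have s: "subspace s" "s \<subseteq> h" "\<And>x y. x \<in> h \<Longrightarrow> y \<in> s \<Longrightarrow> D x y \<in> s \<and> D y x \<in> s"
    using assms split_levi_civita unfolding h.strong_ideal_iff by (auto simp: subset_iff)
  have "D x y \<in> s \<and> D y x \<in> s" if "x \<in> g" "y \<in> s" for x y
  proof -
    obtain u v where uv: "u \<in> h" "v \<in> k" "x = u + v"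
      using split_sum[OF \<open>x \<in> g\<close>] by blast
    then have "D x y = D u y" "D y x = D y u"
      using split_product_0[of y v] split_subset s(2) \<open>y \<in> s\<close>
        bilinear_onD(1,2)[OF bilinear_levi_civita, of u v y]
      by (auto simp: subset_iff)
    then show ?thesis
      using s(3) uv \<open>y \<in> s\<close> by simp
  qed
  then show ?thesis
    using s split_subset unfolding strong_ideal_iff by auto
qed

end

section \<open>Maximal non-degenerate subspaces\<close>

lemma maximal_nondegenerate_subspace_exists:
  assumes "V \<subseteq> g" and "0 \<in> V"
  shows "\<exists>W. maximal_nondegenerate_subspace form V W"
proof -
  obtain S where S: "finite S" "span S = g"
    using finite_dimensional by blast
  let ?P = "\<lambda>W. subspace W \<and> W \<subseteq> V \<and> nondegenerate_on W form"
  have "?P {0}"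
    using assms(2) by (auto simp: nondegenerate_on_def subspace_single_0)
  moreover have "\<forall>W. ?P W \<longrightarrow> dim W < Suc (card S)"
    using S assms by (metis less_Suc_eq_le dim_le_card order_trans)
  \<comment> \<open>Dimensions of candidates are bounded and \<open>{0}\<close> is a candidate, so
    one of greatest dimension exists; a proper enlargement would have larger dimension.\<close>
  ultimately obtain W where W: "?P W" "\<forall>U. ?P U \<longrightarrow> dim U \<le> dim W"
    using ex_has_greatest_nat[of ?P "{0}" dim "Suc (card S)"] by (metis less_imp_le)
  have "U = W" if U: "?P U" "W \<subseteq> U" for U
  proof (rule ccontr)
    assume "U \<noteq> W"
    then have "dim W < dim U"
      using U W(1) S assms by (intro dim_strict_mono[OF _ _ S(1)]) auto
    then show False
      using W(2) U(1) by (meson not_less)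
  qed
  then show ?thesis
    using W(1) unfolding maximal_nondegenerate_subspace_def by blast
qed

text \<open>A vector \<open>x\<close> of \<open>V\<close> orthogonal to \<open>W\<close> with
  \<open>form x x\<close> non-zero could be adjoined to \<open>W\<close> without losing
  non-degeneracy, against maximality. Hence all these vectors are null, and polarization makes the
  form vanish on the subspace they form.\<close>

lemma isotropic_if_maximal_nondegenerate:
  assumes max: "maximal_nondegenerate_subspace form V W"
    and V: "subspace V" "V \<subseteq> g"
  shows "totally_isotropic form (V \<inter> perp W)"
proof -
  note f = bilinear_onD[OF form_bilinear]
  have W: "subspace W" "W \<subseteq> V" "nondegenerate_on W form"
    "\<And>U. subspace U \<Longrightarrow> U \<subseteq> V \<Longrightarrow> nondegenerate_on U form \<Longrightarrow> W \<subseteq> U \<Longrightarrow> U = W"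
    using max unfolding maximal_nondegenerate_subspace_def by auto
  have null: "form x x = 0" if x: "x \<in> V" "x \<in> perp W" for x
  proof (rule ccontr)
    assume n: "form x x \<noteq> 0"
    define U where "U = {w + v | w v. w \<in> W \<and> v \<in> span {x}}"
    have U_iff: "z \<in> U \<longleftrightarrow> (\<exists>w\<in>W. \<exists>c. z = w + c *\<^sub>R x)" for z
      unfolding U_def by (auto simp: span_singleton)
    have "subspace U"
      unfolding U_def by (intro subspace_sums W subspace_span)
    moreover have "U \<subseteq> V"
      using W(2) V(1) x(1) by (auto simp: U_iff intro!: subspace_add subspace_scale)
    moreover have WU: "W \<subseteq> U"
      by (auto simp: U_iff intro!: bexI exI[of _ 0])
    moreover have xU: "x \<in> U"
      using subspace_0[OF W(1)] by (auto simp: U_iff intro!: bexI[of _ 0] exI[of _ 1])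
    moreover have "nondegenerate_on U form"
      unfolding nondegenerate_on_def
    proof (intro ballI impI)
      fix z assume "z \<in> U" and z0: "\<forall>y\<in>U. form z y = 0"
      then obtain w c where w: "w \<in> W" "z = w + c *\<^sub>R x"
        by (auto simp: U_iff)
      have g: "w \<in> g" "x \<in> g" "c *\<^sub>R x \<in> g"
        using w W(2) V x carrier_subspace by (auto intro: subspace_scale)
      have xW: "form x y = 0" if "y \<in> W" for y
        using x(2) that unfolding perp_def by auto
      \<comment> \<open>Pairing with \<open>x\<close> isolates the coefficient \<open>c\<close>;
        once it is zero, pairing with \<open>W\<close> disposes of \<open>w\<close>.\<close>
      have "form z x = c * form x x"
        using f(1)[OF g(1,3,2)] f(3)[OF g(2,2)] w xW[OF w(1)] form_symmetric[OF g(1,2)] by simp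
      then have c: "c = 0"
        using z0 xU n by auto
      then have "\<forall>y\<in>W. form w y = 0"
        using z0 WU w by auto
      then show "z = 0"
        using W(3) w c unfolding nondegenerate_on_def by auto
    qed
    ultimately have "x \<in> W"
      using W(4) by blast
    then show False
      using x(2) n unfolding perp_def by auto
  qed
  show ?thesis
    unfolding totally_isotropic_def
  proof (intro ballI)
    fix x y assume xy: "x \<in> V \<inter> perp W" "y \<in> V \<inter> perp W"
    have "W \<subseteq> g"
      using W(2) V(2) by blast
    then have "x + y \<in> V \<inter> perp W"
      using xy V(1) subspace_perp by (auto intro: subspace_add)
    then have 0: "form (x + y) (x + y) = 0" "form x x = 0" "form y y = 0"
      using null xy by auto
    have g: "x \<in> g" "y \<in> g" "x + y \<in> g"
      using xy V(2) carrier_subspace by (auto intro: subspace_add)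
    have "form (x + y) (x + y) = form x x + form x y + (form y x + form y y)"
      using g by (simp add: f)
    then show "form x y = 0"
      using 0 form_symmetric[OF g(1,2)] by simp
  qed
qed

end

section \<open>The decomposition\<close>

text \<open>Strong induction on the dimension: a decomposable algebra splits into two smaller
  orthogonal parts that inherit both annihilator hypotheses. Collecting the summands in a set lets
  the two resulting families be merged by a union.\<close>

lemma orthogonal_decomposition_into_indecomposables:
  fixes k :: "'a::real_vector set"
  assumes "metric_lie_algebra k br form"
    and "Ann_R k br form = Ann k br form"
    and "totally_isotropic form (Ann_R k br form)"
  shows "\<exists>H. finite H \<and> span (\<Union>H) = k \<and> pairwise_orthogonal form H (\<lambda>h. h) \<and>
      (\<forall>h\<in>H. h \<noteq> {0} \<and> strong_ideal k br form h \<and> nondegenerate_on h form \<and>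
        indecomposable h br form \<and> totally_isotropic form (Ann_R h br form))"
  using assms
proof (induction "dim k" arbitrary: k rule: less_induct)
  case less
  interpret metric_lie_algebra k br form
    by (rule less.prems(1))
  \<comment> \<open>The zero algebra counts as indecomposable, but summands must be non-zero, so it
    is treated separately and receives the empty family.\<close>
  consider "k = {0}" | "k \<noteq> {0}" "indecomposable k br form" | "decomposable k br form"
    by blast
  then show ?case
  proof cases
    case 1
    then show ?thesis
      by (intro exI[of _ "{}"]) (auto simp: pairwise_orthogonal_def)
  next
    case 2
    have "strong_ideal k br form k"
      unfolding strong_ideal_iff using carrier_subspace levi_civita_closed by auto
    moreover have "span k = k"
      using carrier_subspace by (simp add: span_eq_iff)
    ultimately show ?thesis
      using 2 form_nondegenerate less.prems(3)
      by (intro exI[of _ "{k}"]) (auto simp: pairwise_orthogonal_def)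
  next
    case 3
    then obtain a b where split: "orthogonal_split a b" and ab: "a \<subset> k" "b \<subset> k"
      using decomposable_orthogonal_split less.prems(2) by blast
    \<comment> \<open>Stated for either half of a split. The summands obtained are strong ideals of
      \<open>c\<close>, promoted to strong ideals of \<open>k\<close> by transitivity.\<close>
    have IH: "\<exists>H. finite H \<and> span (\<Union>H) = c \<and> pairwise_orthogonal form H (\<lambda>h. h) \<and>
      (\<forall>h\<in>H. h \<noteq> {0} \<and> strong_ideal k br form h \<and> nondegenerate_on h form \<and>
        indecomposable h br form \<and> totally_isotropic form (Ann_R h br form))"
      if c: "orthogonal_split c d" "c \<subset> k" for c d
    proof -
      obtain S where "finite S" "span S = k"
        using finite_dimensional by blast
      then have "dim c < dim k"
        using dim_strict_mono[OF split_subspace[OF c(1)] carrier_subspace] c(2) by auto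
      moreover have "totally_isotropic form (Ann_R c br form)"
        using less.prems(3) split_Ann_R[OF c(1)] unfolding totally_isotropic_def by blast
      ultimately show ?thesis
        using less.hyps[of c] split_metric_lie_algebra[OF c(1)]
          split_Ann_R_eq_Ann[OF c(1) less.prems(2)] split_strong_ideal_trans[OF c(1)] by meson
    qed
    obtain A where A: "finite A" "span (\<Union>A) = a" "pairwise_orthogonal form A (\<lambda>h. h)"
      "\<forall>h\<in>A. h \<noteq> {0} \<and> strong_ideal k br form h \<and> nondegenerate_on h form \<and>
        indecomposable h br form \<and> totally_isotropic form (Ann_R h br form)"
      using IH[OF split ab(1)] by blast
    obtain B where B: "finite B" "span (\<Union>B) = b" "pairwise_orthogonal form B (\<lambda>h. h)"
      "\<forall>h\<in>B. h \<noteq> {0} \<and> strong_ideal k br form h \<and> nondegenerate_on h form \<and>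
        indecomposable h br form \<and> totally_isotropic form (Ann_R h br form)"
      using IH[OF orthogonal_split_sym[OF split] ab(2)] by blast
    have sub: "h \<subseteq> a" if "h \<in> A" for h
      using that A(2) span_superset by blast
    have sub': "h \<subseteq> b" if "h \<in> B" for h
      using that B(2) span_superset by blast
    have "pairwise_orthogonal form (A \<union> B) (\<lambda>h. h)"
      unfolding pairwise_orthogonal_def
    proof (intro ballI impI)
      fix h h' x y
      assume h: "h \<in> A \<union> B" "h' \<in> A \<union> B" "h \<noteq> h'" and xy: "x \<in> h" "y \<in> h'"
      consider "h \<in> A" "h' \<in> A" | "h \<in> B" "h' \<in> B" | "x \<in> a" "y \<in> b" | "x \<in> b" "y \<in> a"
        using h(1,2) xy subsetD[OF sub] subsetD[OF sub'] by (elim UnE) simp_all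
      then show "form x y = 0"
      proof cases
        case 1
        then show ?thesis
          using A(3) h(3) xy by (simp add: pairwise_orthogonal_def)
      next
        case 2
        then show ?thesis
          using B(3) h(3) xy by (simp add: pairwise_orthogonal_def)
      next
        case 3
        then show ?thesis
          by (rule split_orthogonal[OF split])
      next
        case 4
        then show ?thesis
          by (rule split_orthogonal[OF orthogonal_split_sym[OF split]])
      qed
    qed
    moreover have "span (\<Union>(A \<union> B)) = k"
    proof -
      have "span (\<Union>(A \<union> B)) = {x + y | x y. x \<in> a \<and> y \<in> b}"
        unfolding Union_Un_distrib span_Un A(2) B(2) by blast
      also have "\<dots> = k"
        by (rule split_eq_sum[OF split])
      finally show ?thesis .
    qed
    ultimately show ?thesis
      using A(1,4) B(1,4) by (intro exI[of _ "A \<union> B"]) auto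
  qed
qed

theorem proposition3p7:
  fixes g :: "'a::real_vector set"
    and br :: "'a \<Rightarrow> 'a \<Rightarrow> 'a"
    and form :: "'a \<Rightarrow> 'a \<Rightarrow> real"
  assumes "metric_lie_algebra g br form"
    and "Ann_R g br form = Ann g br form"
  shows "\<exists>(l::nat) (h :: nat \<Rightarrow> 'a set).
           direct_sum_decomposition g {0..l} h \<and>
           pairwise_orthogonal form {0..l} h \<and>
           maximal_nondegenerate_subspace form (Ann g br form) (h 0) \<and>
           (\<forall>i\<in>{1..l}.
              h i \<noteq> {0} \<and>
              strong_ideal g br form (h i) \<and>
              nondegenerate_on (h i) form \<and>
              indecomposable (h i) br form \<and>
              totally_isotropic form (Ann_R (h i) br form))"
proof -
  interpret metric_lie_algebra g br form
    by (rule assms(1))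
  have Ann_sub: "Ann g br form \<subseteq> g"
    unfolding Ann_def by auto
  obtain W where max: "maximal_nondegenerate_subspace form (Ann g br form) W"
    using maximal_nondegenerate_subspace_exists[OF Ann_sub subspace_0[OF subspace_Ann]] by blast
  then have W: "subspace W" "W \<subseteq> Ann g br form" "nondegenerate_on W form"
    unfolding maximal_nondegenerate_subspace_def by auto
  have DW: "D x y = 0" "D y x = 0" if "x \<in> g" "y \<in> W" for x y
    using W(2) that unfolding Ann_def by auto
  \<comment> \<open>All products with a vector of \<open>W\<close> vanish because \<open>W\<close>
    lies in the annihilator. The same fact supplies the hypothesis for splitting off
    \<open>perp W\<close>.\<close>
  have "strong_ideal g br form W"
    unfolding strong_ideal_iff using W Ann_sub DW subspace_0 by auto
  then have split: "orthogonal_split W (perp W)"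
    using W(3) DW by (intro orthogonal_split_perpI) (auto simp: perp_def)
  note split' = orthogonal_split_sym[OF split]
  \<comment> \<open>Maximality of \<open>W\<close> is used through this inclusion: the part of the
    annihilator orthogonal to \<open>W\<close> is totally isotropic.\<close>
  have "Ann_R (perp W) br form \<subseteq> Ann g br form \<inter> perp W"
    using split_Ann_R[OF split'] assms(2) unfolding Ann_R_def by auto
  then have "totally_isotropic form (Ann_R (perp W) br form)"
    using isotropic_if_maximal_nondegenerate[OF max subspace_Ann Ann_sub]
    unfolding totally_isotropic_def by blast
  then obtain H where H: "finite H" "span (\<Union>H) = perp W" "pairwise_orthogonal form H (\<lambda>h. h)"
      "\<And>h. h \<in> H \<Longrightarrow> h \<noteq> {0} \<and> strong_ideal (perp W) br form h \<and> nondegenerate_on h form \<and>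
        indecomposable h br form \<and> totally_isotropic form (Ann_R h br form)"
    using orthogonal_decomposition_into_indecomposables[OF split_metric_lie_algebra[OF split']
        split_Ann_R_eq_Ann[OF split' assms(2)]] by blast
  \<comment> \<open>Enumeration from 1 leaves index 0 for \<open>W\<close>; an empty
    \<open>H\<close> gives the case without further summands.\<close>
  obtain e where e: "bij_betw e {1..card H} H"
    using ex_bij_betw_nat_finite_1[OF H(1)] by blast
  define h where "h i = (if i = 0 then W else e i)" for i
  have h0: "h 0 = W"
    by (simp add: h_def)
  have hH: "h i \<in> H" if "i \<in> {1..card H}" for i
    using that e by (auto simp: h_def bij_betw_def)
  have image: "h ` {1..card H} = H"
    using e by (auto simp: h_def bij_betw_def)
  have h_perp: "h i \<subseteq> perp W" if "i \<in> {1..card H}" for i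
    using hH[OF that] H(2) span_superset by blast
  have cases: "i = 0 \<or> i \<in> {1..card H}" if "i \<in> {0..card H}" for i
    using that by auto
  have strong: "strong_ideal g br form (h i)" if "i \<in> {0..card H}" for i
    using cases[OF that] hH H(4) split_strong_ideal_trans[OF split']
      \<open>strong_ideal g br form W\<close> h0 by auto
  have nondeg: "nondegenerate_on (h i) form" if "i \<in> {0..card H}" for i
    using cases[OF that] hH H(4) W(3) h0 by auto
  have orth: "pairwise_orthogonal form {0..card H} h"
    unfolding pairwise_orthogonal_def
  proof (intro ballI impI)
    fix i j x y
    assume ij: "i \<in> {0..card H}" "j \<in> {0..card H}" "i \<noteq> j" and xy: "x \<in> h i" "y \<in> h j"
    consider "i = 0" "j \<in> {1..card H}" | "j = 0" "i \<in> {1..card H}"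
      | "i \<in> {1..card H}" "j \<in> {1..card H}"
      using ij cases by blast
    then show "form x y = 0"
    proof cases
      case 1
      then show ?thesis
        using xy h0 h_perp split_orthogonal[OF split] by blast
    next
      case 2
      then show ?thesis
        using xy h0 h_perp split_orthogonal[OF split'] by blast
    next
      case 3
      \<comment> \<open>Orthogonality in \<open>H\<close> is known for distinct members, so
        injectivity of the enumeration is required to pass from distinct indices to distinct
        summands.\<close>
      then have "h i \<noteq> h j"
        using inj_onD[OF bij_betw_imp_inj_on[OF e], of i j] ij(3) by (auto simp: h_def)
      then show ?thesis
        using H(3) hH[OF 3(1)] hH[OF 3(2)] xy by (simp add: pairwise_orthogonal_def)
    qed
  qed
  have "{0..card H} = insert 0 {1..card H}"
    by auto
  then have "(\<Union>i\<in>{0..card H}. h i) = W \<union> \<Union>H"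
    using image h0 by auto
  then have "span (\<Union>i\<in>{0..card H}. h i) = {x + y | x y. x \<in> W \<and> y \<in> perp W}"
    using W(1) by (simp only: span_Un H(2) span_eq_iff[THEN iffD2])
  also have "\<dots> = g"
    by (rule split_eq_sum[OF split])
  finally have "span (\<Union>i\<in>{0..card H}. h i) = g" .
  then have "direct_sum_decomposition g {0..card H} h"
    using strong nondeg orth
    by (intro direct_sum_decompositionI[OF _ carrier_subspace form_bilinear])
      (auto simp: strong_ideal_def)
  then show ?thesis
    using orth max h0 strong hH H(4) by (intro exI[of _ "card H"] exI[of _ h]) auto
qed

end
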